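(* Let $a,b\in\mathbb{R}\setminus\{0\}$ and let $\mathcal{C}\subset\mathbb{CP}^2$ be the complex conic with affine equation $\frac{x^2}{a}+\frac{y^2}{b}=1$. Let $T=(p_0,p_1,p_2)$ be a non-degenerate and non-isotropic orbit on $\mathcal{C}$ with $p_0$ finite. Then the quantity $P(p_j,v)$ does not depend on the choice of a finite vertex $p_j$ of $T$, nor on the choice of a directing vector $v$ of a side $p_{j-1}p_j$ or $p_jp_{j+1}$ of $T$ containing $p_j$.
   Context: Use homogeneous coordinates $(x:y:z)$ on $\mathbb{CP}^2$, identify $\mathbb{C}^2$ with $\{z=1\}$, let $L_\infty=\{z=0\}$ and $q(x,y)=x^2+y^2$ on $\mathbb{C}^2$. A point is finite if it lies in $\mathbb{C}^2$ and infinite if it lies on $L_\infty$. Let $I=(1:i:0)$, $J=(1:-i:0)$; a line is isotropic if it contains $I$ or $J$ (in particular $L_\infty$ is isotropic); a finite line is isotropic iff its directing vectors $v$ satisfy $q(v)=0$. For a non-isotropic line $L$, the symmetry with respect to $L$ is the unique non-trivial complex affine involution of $\mathbb{C}^2$ preserving $q$ and fixing the points of $L$; it extends to $\mathbb{CP}^2$ and acts on lines. A non-degenerate orbit on $\mathcal{C}$ is a finite sequence $(p_0,\dots,p_n)$ of points of $\mathcal{C}$ such that $p_j\ne p_{j+1}$ for all $j<n$, every tangent line $T_{p_j}\mathcal{C}$ is non-isotropic, and for $0<j<n$ the lines $p_{j-1}p_j$ and $p_jp_{j+1}$ are symmetric with respect to $T_{p_j}\mathcal{C}$. Its sides are the lines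 $p_jp_{j+1}$. It is non-isotropic if none of its sides is isotropic. For a finite point $p=(x,y)\in\mathbb{C}^2$ and $v=(v_x,v_y)\in\mathbb{C}^2$ with $q(v)\neq0$, the complex Joachimsthal invariant is $$P(p,v)=\frac{1}{q(v)}\left(\frac{xv_x}{a}+\frac{yv_y}{b}\right)^2.$$ *)

theory Defs
  imports "HOL-Analysis.Analysis"
begin

definition proportional :: "complex^3 \<Rightarrow> complex^3 \<Rightarrow> bool" where
  "proportional v w \<longleftrightarrow> v \<noteq> 0 \<and> w \<noteq> 0 \<and> (\<exists>c. c \<noteq> 0 \<and> w = c *s v)"

quotient_type cp2 = "complex^3" / partial: proportional
proof (rule part_equivpI)
  show "\<exists>v. proportional v v"
    by (intro exI[of _ "axis 1 1"]) (auto simp: proportional_def axis_eq_0_iff intro!: exI[of _ 1])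
  show "symp proportional"
  proof (rule sympI)
    fix v w assume "proportional v w"
    then obtain c where "v \<noteq> 0" "w \<noteq> 0" "c \<noteq> 0" "w = c *s v"
      by (auto simp: proportional_def)
    then show "proportional w v"
      by (auto simp: proportional_def vector_smult_assoc intro!: exI[of _ "inverse c"])
  qed
  show "transp proportional"
  proof (rule transpI)
    fix u v w assume "proportional u v" "proportional v w"
    then obtain c d where "u \<noteq> 0" "w \<noteq> 0" "c \<noteq> 0" "v = c *s u" "d \<noteq> 0" "w = d *s v"
      by (auto simp: proportional_def)
    then show "proportional u w"
      by (auto simp: proportional_def vector_smult_assoc intro!: exI[of _ "d * c"])
  qed
qed

text \<open>The class of a nonzero vector of homogeneous coordinates; \<open>proj 0\<close> is meaningless.\<close>

abbreviation proj :: "complex^3 \<Rightarrow> cp2" where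
  "proj \<equiv> abs_cp2"

definition affine_point :: "complex^2 \<Rightarrow> cp2" where
  "affine_point p = proj (vector [p$1, p$2, 1])"

definition finite_point :: "cp2 \<Rightarrow> bool" where
  "finite_point P \<longleftrightarrow> (\<exists>p. P = affine_point p)"

definition is_line :: "cp2 set \<Rightarrow> bool" where
  "is_line L \<longleftrightarrow>
     (\<exists>n::complex^3. n \<noteq> 0 \<and> L = {proj v | v. v \<noteq> 0 \<and> (\<Sum>i\<in>UNIV. n$i * v$i) = 0})"

text \<open>Only meaningful for \<open>P \<noteq> Q\<close>.\<close>

definition line_through :: "cp2 \<Rightarrow> cp2 \<Rightarrow> cp2 set" where
  "line_through P Q = (THE L. is_line L \<and> P \<in> L \<and> Q \<in> L)"

definition isotropic :: "cp2 set \<Rightarrow> bool" where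
  "isotropic L \<longleftrightarrow> proj (vector [1, \<i>, 0]) \<in> L \<or> proj (vector [1, -\<i>, 0]) \<in> L"

text \<open>This forces the line \<open>L\<close> to be finite.\<close>

definition directing_vector :: "complex^2 \<Rightarrow> cp2 set \<Rightarrow> bool" where
  "directing_vector v L \<longleftrightarrow>
     v \<noteq> 0 \<and> (\<exists>p. {w. affine_point w \<in> L} = range (\<lambda>t. p + t *s v))"

definition quad :: "complex^2 \<Rightarrow> complex" where
  "quad v = (v$1)^2 + (v$2)^2"

text \<open>That an affine map preserves \<open>quad\<close> means that its linear part does.\<close>

definition is_symmetry :: "cp2 set \<Rightarrow> (complex^2 \<Rightarrow> complex^2) \<Rightarrow> bool" where
  "is_symmetry L s \<longleftrightarrow>
     (\<exists>A t. s = (\<lambda>p. A *v p + t) \<and> (\<forall>v. quad (A *v v) = quad v)) \<and>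
     s \<circ> s = id \<and> s \<noteq> id \<and> (\<forall>p. affine_point p \<in> L \<longrightarrow> s p = p)"

text \<open>Only meaningful for non-isotropic lines \<open>L\<close>.\<close>

definition symmetry :: "cp2 set \<Rightarrow> complex^2 \<Rightarrow> complex^2" where
  "symmetry L = (THE s. is_symmetry L s)"

definition projective_map :: "(cp2 \<Rightarrow> cp2) \<Rightarrow> bool" where
  "projective_map g \<longleftrightarrow>
     (\<exists>M::complex^3^3. invertible M \<and> (\<forall>v. v \<noteq> 0 \<longrightarrow> g (proj v) = proj (M *v v)))"

definition projective_extension :: "(complex^2 \<Rightarrow> complex^2) \<Rightarrow> cp2 \<Rightarrow> cp2" where
  "projective_extension s =
     (THE g. projective_map g \<and> (\<forall>p. g (affine_point p) = affine_point (s p)))"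

definition symmetric_lines :: "cp2 set \<Rightarrow> cp2 set \<Rightarrow> cp2 set \<Rightarrow> bool" where
  "symmetric_lines L M N \<longleftrightarrow> projective_extension (symmetry L) ` M = N"

text \<open>Homogenisation of \<open>x\<^sup>2/a + y\<^sup>2/b = 1\<close>.\<close>

definition conic_form :: "real \<Rightarrow> real \<Rightarrow> complex^3 \<Rightarrow> complex" where
  "conic_form a b v = (v$1)^2 / of_real a + (v$2)^2 / of_real b - (v$3)^2"

definition conic :: "real \<Rightarrow> real \<Rightarrow> cp2 set" where
  "conic a b = {proj v | v. v \<noteq> 0 \<and> conic_form a b v = 0}"

text \<open>The kernel of the differential of the homogeneous equation; it does not depend
  on the coordinates \<open>v\<close> chosen for \<open>P\<close>.\<close>

definition tangent_line :: "real \<Rightarrow> real \<Rightarrow> cp2 \<Rightarrow> cp2 set" where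
  "tangent_line a b P = {proj w | v w. v \<noteq> 0 \<and> w \<noteq> 0 \<and> P = proj v \<and>
     frechet_derivative (conic_form a b) (at v) w = 0}"

definition side :: "cp2 list \<Rightarrow> nat \<Rightarrow> cp2 set" where
  "side T j = line_through (T ! j) (T ! Suc j)"

definition nondegenerate_orbit :: "real \<Rightarrow> real \<Rightarrow> cp2 list \<Rightarrow> bool" where
  "nondegenerate_orbit a b T \<longleftrightarrow>
     T \<noteq> [] \<and> set T \<subseteq> conic a b \<and>
     (\<forall>j. Suc j < length T \<longrightarrow> T ! j \<noteq> T ! Suc j) \<and>
     (\<forall>j < length T. \<not> isotropic (tangent_line a b (T ! j))) \<and>
     (\<forall>j. Suc (Suc j) < length T \<longrightarrow>
        symmetric_lines (tangent_line a b (T ! Suc j)) (side T j) (side T (Suc j)))"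

definition non_isotropic_orbit :: "cp2 list \<Rightarrow> bool" where
  "non_isotropic_orbit T \<longleftrightarrow> (\<forall>j. Suc j < length T \<longrightarrow> \<not> isotropic (side T j))"

definition joachimsthal :: "real \<Rightarrow> real \<Rightarrow> complex^2 \<Rightarrow> complex^2 \<Rightarrow> complex" where
  "joachimsthal a b p v =
     (1 / quad v) * (p$1 * v$1 / of_real a + p$2 * v$2 / of_real b)^2"

end

theory Submission imports Defs begin

text \<open>
  The Joachimsthal invariant is a function of the line alone. Let a finite point \<open>p\<close> of the
  conic lie on the line \<open>n\<^sub>1 x + n\<^sub>2 y + n\<^sub>3 = 0\<close>, whose directing vectors are the
  multiples of \<open>(n\<^sub>2, - n\<^sub>1)\<close>. Lagrange's identity, applied to the equation of the conic and
  the incidence of \<open>p\<close> with the line, gives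
  \<open>P(p, v) = (a n\<^sub>1\<^sup>2 + b n\<^sub>2\<^sup>2 - n\<^sub>3\<^sup>2) / (a b (n\<^sub>1\<^sup>2 + n\<^sub>2\<^sup>2))\<close>
  (\<open>joachimsthal_eq_line_joachimsthal\<close>), a quotient of the equation of the dual conic by that of
  the dual of the pair of isotropic points. So any finite vertex on a side gives the same value,
  and the two sides remain to be compared.

  The symmetry with respect to the tangent \<open>\<tau>\<close> at the middle vertex acts on lines by
  \<open>m \<mapsto> m - k \<tau>\<close>, an orthogonal reflection for the denominator form
  (\<open>reflection_image_line_of\<close>). It also preserves the numerator form on the pencil of lines
  through the middle vertex: \<open>\<tau>\<close> is isotropic for that form because it is tangent to the conic,
  and orthogonal to \<open>m\<close> because \<open>m\<close> passes through the point of tangency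
  (\<open>line_joachimsthal_reflect_normal\<close>). Since this is a computation in homogeneous coordinates,
  vertices at infinity need no separate treatment.

  The geometric part identifies the objects given by definite descriptions with explicit formulas:
  the line through two points, the symmetry with respect to a line, and its projective extension.
\<close>

section \<open>Points and lines of the projective plane\<close>

abbreviation pairing :: "complex^3 \<Rightarrow> complex^3 \<Rightarrow> complex" where
  "pairing n v \<equiv> (\<Sum>i\<in>UNIV. n$i * v$i)"

definition line_of :: "complex^3 \<Rightarrow> cp2 set" where
  "line_of n = {proj v | v. v \<noteq> 0 \<and> pairing n v = 0}"

lemma vec3_eq_0_iff: "(v::complex^3) = 0 \<longleftrightarrow> v$1 = 0 \<and> v$2 = 0 \<and> v$3 = 0"
  by (simp add: vec_eq_iff forall_3)

lemma proj_eq_iff: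
  assumes "v \<noteq> 0" "w \<noteq> 0"
  shows "proj v = proj w \<longleftrightarrow> (\<exists>c. c \<noteq> 0 \<and> w = c *s v)"
proof -
  have refl: "proportional u u" if "u \<noteq> 0" for u
    using that by (auto simp: proportional_def intro!: exI[of _ 1])
  have "proj v = proj w \<longleftrightarrow> proportional v w"
    using Quotient3_rel[OF Quotient3_cp2, of v w] refl assms by auto
  then show ?thesis using assms by (simp add: proportional_def)
qed

lemma proj_cases:
  obtains v where "v \<noteq> 0" "P = proj v"
proof -
  have "\<exists>v. v \<noteq> 0 \<and> P = proj v"
    by (induct P rule: cp2.abs_induct) (auto simp: proportional_def)
  then show ?thesis using that by blast
qed

lemma pairing_scale: "pairing n (c *s v) = c * pairing n v"
  by (simp add: sum_3 algebra_simps)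

lemma proj_in_line_of_iff:
  assumes "v \<noteq> 0"
  shows "proj v \<in> line_of n \<longleftrightarrow> pairing n v = 0"
proof
  assume "proj v \<in> line_of n"
  then obtain w where w: "w \<noteq> 0" "pairing n w = 0" "proj v = proj w"
    by (auto simp: line_of_def)
  then obtain c where "c \<noteq> 0" "w = c *s v" using proj_eq_iff assms by blast
  with w(2) show "pairing n v = 0" by (simp only: pairing_scale) simp
qed (use assms in \<open>auto simp: line_of_def\<close>)

lemma affine_in_line_of_iff:
  "affine_point p \<in> line_of n \<longleftrightarrow> n$1 * p$1 + n$2 * p$2 + n$3 = 0"
  unfolding affine_point_def
  by (subst proj_in_line_of_iff) (auto simp: vec3_eq_0_iff vector_3 sum_3)

lemma isotropic_line_of_iff:
  "isotropic (line_of n) \<longleftrightarrow> (n$1)^2 + (n$2)^2 = 0"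
proof -
  have 1: "proj (vector [1, \<i>, 0]) \<in> line_of n \<longleftrightarrow> n$1 + \<i> * n$2 = 0"
    by (subst proj_in_line_of_iff) (auto simp: vec3_eq_0_iff vector_3 sum_3 algebra_simps)
  have 2: "proj (vector [1, -\<i>, 0]) \<in> line_of n \<longleftrightarrow> n$1 - \<i> * n$2 = 0"
    by (subst proj_in_line_of_iff) (auto simp: vec3_eq_0_iff vector_3 sum_3 algebra_simps)
  have "(n$1)^2 + (n$2)^2 = (n$1 + \<i> * n$2) * (n$1 - \<i> * n$2)"
    by (simp add: algebra_simps power2_eq_square)
  then show ?thesis by (simp only: isotropic_def 1 2) simp
qed

definition cross :: "complex^3 \<Rightarrow> complex^3 \<Rightarrow> complex^3" where
  "cross u w = vector [u$2 * w$3 - u$3 * w$2, u$3 * w$1 - u$1 * w$3, u$1 * w$2 - u$2 * w$1]"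

lemma cross_eq_0_imp_multiple:
  assumes "cross u w = 0" "u \<noteq> 0"
  shows "\<exists>c. w = c *s u"
proof -
  have e: "u$2 * w$3 = u$3 * w$2" "u$3 * w$1 = u$1 * w$3" "u$1 * w$2 = u$2 * w$1"
    using assms(1) by (auto simp: cross_def vec3_eq_0_iff vector_3)
  consider "u$1 \<noteq> 0" | "u$2 \<noteq> 0" | "u$3 \<noteq> 0" using assms(2) by (auto simp: vec3_eq_0_iff)
  then show ?thesis
  proof cases
    case 1
    then show ?thesis using e
      by (intro exI[of _ "w$1 / u$1"]) (simp add: vec_eq_iff forall_3 field_simps)
  next
    case 2
    then show ?thesis using e
      by (intro exI[of _ "w$2 / u$2"]) (simp add: vec_eq_iff forall_3 field_simps)
  next
    case 3
    then show ?thesis using e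
      by (intro exI[of _ "w$3 / u$3"]) (simp add: vec_eq_iff forall_3 field_simps)
  qed
qed

text \<open>The double cross product \<open>(u \<times> w) \<times> n\<close> is \<open>pairing n u\<close> times \<open>w\<close> minus
  \<open>pairing n w\<close> times \<open>u\<close>; its vanishing gives the uniqueness of the line through two points.\<close>

lemma pairing_0_imp_multiple_cross:
  assumes "cross u w \<noteq> 0" "pairing n u = 0" "pairing n w = 0"
  shows "\<exists>c. n = c *s cross u w"
proof -
  have e: "n$1*u$1 + n$2*u$2 + n$3*u$3 = 0" "n$1*w$1 + n$2*w$2 + n$3*w$3 = 0"
    using assms by (simp_all add: sum_3)
  have "cross (cross u w) n = 0"
    unfolding vec3_eq_0_iff cross_def vector_3 using e by (intro conjI; algebra)
  from cross_eq_0_imp_multiple[OF this assms(1)] show ?thesis .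
qed

lemma line_of_scale: "c \<noteq> 0 \<Longrightarrow> line_of (c *s n) = line_of n"
proof -
  assume "c \<noteq> 0"
  moreover have "pairing (c *s n) v = c * pairing n v" for v
    by (simp add: sum_3 algebra_simps)
  ultimately show ?thesis unfolding line_of_def by simp
qed

lemma line_through_is_line_of:
  assumes "P \<noteq> Q"
  shows "\<exists>n. n \<noteq> 0 \<and> line_through P Q = line_of n \<and> P \<in> line_of n \<and> Q \<in> line_of n"
proof -
  obtain u where u: "u \<noteq> 0" "P = proj u" by (rule proj_cases)
  obtain w where w: "w \<noteq> 0" "Q = proj w" by (rule proj_cases)
  have nz: "cross u w \<noteq> 0"
  proof
    assume "cross u w = 0"
    then obtain c where c: "w = c *s u" using cross_eq_0_imp_multiple u by blast
    with w have "c \<noteq> 0" by auto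
    with c have "P = Q" using u w proj_eq_iff by blast
    with assms show False ..
  qed
  let ?n = "cross u w"
  have inc: "P \<in> line_of ?n" "Q \<in> line_of ?n"
    unfolding u(2) w(2) proj_in_line_of_iff[OF u(1)] proj_in_line_of_iff[OF w(1)]
    by (simp_all add: cross_def vector_3 sum_3 algebra_simps)
  have "line_through P Q = line_of ?n"
    unfolding line_through_def
  proof (rule the_equality)
    show "is_line (line_of ?n) \<and> P \<in> line_of ?n \<and> Q \<in> line_of ?n"
      using nz inc unfolding is_line_def line_of_def by blast
  next
    fix L assume L: "is_line L \<and> P \<in> L \<and> Q \<in> L"
    then obtain m where m: "m \<noteq> 0" "L = line_of m" unfolding is_line_def line_of_def by blast
    with L have "pairing m u = 0" "pairing m w = 0" using u w proj_in_line_of_iff by auto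
    then obtain c where "m = c *s ?n" using pairing_0_imp_multiple_cross nz by blast
    with m show "L = line_of ?n" using line_of_scale by auto
  qed
  then show ?thesis using nz inc by blast
qed

section \<open>Points and tangents of the conic\<close>

lemma proj_in_conic_iff:
  assumes "v \<noteq> 0"
  shows "proj v \<in> conic a b \<longleftrightarrow> conic_form a b v = 0"
proof
  assume "proj v \<in> conic a b"
  then obtain w where w: "w \<noteq> 0" "conic_form a b w = 0" "proj v = proj w"
    by (auto simp: conic_def)
  then obtain c where c: "c \<noteq> 0" "w = c *s v" using proj_eq_iff assms by blast
  then have "conic_form a b w = c^2 * conic_form a b v"
    by (simp add: conic_form_def power_mult_distrib algebra_simps)
  with w c show "conic_form a b v = 0" by simp
qed (use assms in \<open>auto simp: conic_def\<close>)

text \<open>Half the gradient of the homogeneous equation at \<open>u\<close>: the normal of the polar line of \<open>u\<close>.\<close>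

definition polar :: "real \<Rightarrow> real \<Rightarrow> complex^3 \<Rightarrow> complex^3" where
  "polar a b u = vector [u$1 / of_real a, u$2 / of_real b, - u$3]"

lemma frechet_derivative_conic_form:
  "frechet_derivative (conic_form a b) (at v) w = 2 * pairing (polar a b v) w"
proof -
  have nth: "((\<lambda>v::complex^3. v$i) has_derivative (\<lambda>w. w$i)) (at v)" for i
    by (rule bounded_linear.has_derivative[OF bounded_linear_vec_nth has_derivative_ident])
  define \<alpha> \<beta> :: complex where "\<alpha> = 1 / of_real a" and "\<beta> = 1 / of_real b"
  have "((\<lambda>v. \<alpha> * (v$1 * v$1) + \<beta> * (v$2 * v$2) - v$3 * v$3) has_derivative
      (\<lambda>w. \<alpha> * (v$1 * w$1 + w$1 * v$1) + \<beta> * (v$2 * w$2 + w$2 * v$2)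
        - (v$3 * w$3 + w$3 * v$3))) (at v)"
    by (intro has_derivative_add has_derivative_diff has_derivative_mult_right has_derivative_mult nth)
  moreover have "(\<lambda>w. \<alpha> * (v$1 * w$1 + w$1 * v$1) + \<beta> * (v$2 * w$2 + w$2 * v$2)
        - (v$3 * w$3 + w$3 * v$3)) = (\<lambda>w. 2 * pairing (polar a b v) w)"
    by (simp add: polar_def vector_3 sum_3 fun_eq_iff \<alpha>_def \<beta>_def algebra_simps)
  moreover have "(\<lambda>v. \<alpha> * (v$1 * v$1) + \<beta> * (v$2 * v$2) - v$3 * v$3) = conic_form a b"
    by (simp add: conic_form_def fun_eq_iff \<alpha>_def \<beta>_def power2_eq_square)
  ultimately have "(conic_form a b has_derivative (\<lambda>w. 2 * pairing (polar a b v) w)) (at v)"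
    by (simp only:)
  then have "(\<lambda>w. 2 * pairing (polar a b v) w) = frechet_derivative (conic_form a b) (at v)"
    by (rule frechet_derivative_at)
  from fun_cong[OF this, of w] show ?thesis by (rule sym)
qed

lemma tangent_line_eq_polar:
  assumes "u \<noteq> 0"
  shows "tangent_line a b (proj u) = line_of (polar a b u)"
proof -
  have scale: "pairing (polar a b (c *s u)) w = c * pairing (polar a b u) w" for c w
    by (simp add: polar_def vector_3 sum_3 algebra_simps)
  have "(\<exists>v. v \<noteq> 0 \<and> proj u = proj v \<and> 2 * pairing (polar a b v) w = 0)
      \<longleftrightarrow> pairing (polar a b u) w = 0" for w
  proof
    assume "\<exists>v. v \<noteq> 0 \<and> proj u = proj v \<and> 2 * pairing (polar a b v) w = 0"
    then obtain v where v: "v \<noteq> 0" "proj u = proj v" "2 * pairing (polar a b v) w = 0" by blast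
    then obtain c where c: "c \<noteq> 0" "v = c *s u" using proj_eq_iff assms by blast
    have "c * pairing (polar a b u) w = 0"
      using v(3) unfolding c(2) scale by simp
    with c show "pairing (polar a b u) w = 0" by simp
  qed (use assms in auto)
  then show ?thesis
    unfolding tangent_line_def line_of_def frechet_derivative_conic_form by blast
qed

section \<open>Reflections and their action on lines\<close>

text \<open>The usual formula for the orthogonal reflection in the line with normal \<open>n\<close>, with the complex
  bilinear form in place of a scalar product; it makes sense for non-isotropic lines.
  \<open>reflection_matrix\<close> is its action on homogeneous coordinates of points, \<open>reflect_normal\<close> that
  on homogeneous coordinates of lines.\<close>

definition reflection :: "complex^3 \<Rightarrow> complex^2 \<Rightarrow> complex^2" where
  "reflection n p = p - (2 * (n$1 * p$1 + n$2 * p$2 + n$3) / ((n$1)^2 + (n$2)^2)) *s vector [n$1, n$2]"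

definition reflection_matrix :: "complex^3 \<Rightarrow> complex^3^3" where
  "reflection_matrix n = (\<chi> i j. (if i = j then 1 else 0)
     - 2 / ((n$1)^2 + (n$2)^2) * (if i = 3 then 0 else n$i) * n$j)"

definition reflect_normal :: "complex^3 \<Rightarrow> complex^3 \<Rightarrow> complex^3" where
  "reflect_normal n m = m - (2 * (n$1 * m$1 + n$2 * m$2) / ((n$1)^2 + (n$2)^2)) *s n"

lemma reflection_nth:
  "reflection n p $ 1 = p$1 - 2 * (n$1 * p$1 + n$2 * p$2 + n$3) / ((n$1)^2 + (n$2)^2) * n$1"
  "reflection n p $ 2 = p$2 - 2 * (n$1 * p$1 + n$2 * p$2 + n$3) / ((n$1)^2 + (n$2)^2) * n$2"
  by (simp_all add: reflection_def vector_2)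

lemma reflection_matrix_mult_nth:
  "(reflection_matrix n *v v) $ 1 = v$1 - 2 * pairing n v / ((n$1)^2 + (n$2)^2) * n$1"
  "(reflection_matrix n *v v) $ 2 = v$2 - 2 * pairing n v / ((n$1)^2 + (n$2)^2) * n$2"
  "(reflection_matrix n *v v) $ 3 = v$3"
proof -
  define i where "i = inverse ((n$1)^2 + (n$2)^2)"
  have i: "x / ((n$1)^2 + (n$2)^2) = x * i" for x
    by (simp add: i_def divide_inverse)
  show "(reflection_matrix n *v v) $ 1 = v$1 - 2 * pairing n v / ((n$1)^2 + (n$2)^2) * n$1"
    "(reflection_matrix n *v v) $ 2 = v$2 - 2 * pairing n v / ((n$1)^2 + (n$2)^2) * n$2"
    "(reflection_matrix n *v v) $ 3 = v$3"
    unfolding i by (simp_all add: reflection_matrix_def i matrix_vector_mult_def sum_3 algebra_simps)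
qed

lemma reflection_matrix_involution:
  assumes "(n$1)^2 + (n$2)^2 \<noteq> 0"
  shows "reflection_matrix n *v (reflection_matrix n *v v) = v"
proof -
  let ?Q = "(n$1)^2 + (n$2)^2" and ?M = "reflection_matrix n"
  define k where "k = 2 * pairing n v / ?Q"
  have kQ: "k * ?Q = 2 * pairing n v" using assms by (simp add: k_def)
  have "pairing n (?M *v v) = pairing n v - k * ?Q"
    unfolding sum_3[of "\<lambda>i. n$i * (?M *v v)$i"] reflection_matrix_mult_nth k_def[symmetric]
    by (simp add: sum_3 algebra_simps power2_eq_square)
  then have "pairing n (?M *v v) = - pairing n v" using kQ by simp
  then have "2 * pairing n (?M *v v) / ?Q = - k" by (simp add: k_def)
  then show ?thesis
    unfolding vec_eq_iff forall_3 reflection_matrix_mult_nth by (simp add: k_def)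
qed

text \<open>The action on lines is by the transpose; the reflection being an involution, no inverse
  appears.\<close>

lemma pairing_reflection_matrix:
  "pairing m (reflection_matrix n *v v) = pairing (reflect_normal n m) v"
proof -
  define i where "i = inverse ((n$1)^2 + (n$2)^2)"
  have i: "x / ((n$1)^2 + (n$2)^2) = x * i" for x
    by (simp add: i_def divide_inverse)
  show ?thesis
    unfolding sum_3[of "\<lambda>j. m$j * (reflection_matrix n *v v)$j"] reflection_matrix_mult_nth i
    by (simp add: sum_3 reflect_normal_def i algebra_simps)
qed

lemma vec2_eq_iff: "(v::complex^2) = w \<longleftrightarrow> v$1 = w$1 \<and> v$2 = w$2"
  by (simp add: vec_eq_iff forall_2)

lemma is_symmetry_reflection:
  assumes Q: "(n$1)^2 + (n$2)^2 \<noteq> 0"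
  shows "is_symmetry (line_of n) (reflection n)"
proof -
  let ?Q = "(n$1)^2 + (n$2)^2"
  define A :: "complex^2^2" where
    "A = (\<chi> i j. (if i = j then 1 else 0)
       - 2 / ?Q * (if i = 1 then n$1 else n$2) * (if j = 1 then n$1 else n$2))"
  define t :: "complex^2" where "t = - (2 * n$3 / ?Q) *s vector [n$1, n$2]"
  have A: "(A *v v)$1 = v$1 - 2 * (n$1 * v$1 + n$2 * v$2) / ?Q * n$1"
    "(A *v v)$2 = v$2 - 2 * (n$1 * v$1 + n$2 * v$2) / ?Q * n$2" for v
    by (simp_all add: A_def matrix_vector_mult_def sum_2 algebra_simps add_divide_distrib)
  have 1: "reflection n = (\<lambda>p. A *v p + t)"
    by (simp add: fun_eq_iff vec2_eq_iff reflection_nth A t_def vector_2 algebra_simps add_divide_distrib)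
  have 2: "quad (A *v v) = quad v" for v
  proof -
    define k where "k = 2 * (n$1 * v$1 + n$2 * v$2) / ?Q"
    have "k * ?Q = 2 * (n$1 * v$1 + n$2 * v$2)" using Q by (simp add: k_def)
    then show ?thesis unfolding quad_def A k_def[symmetric] by algebra
  qed
  have 3: "reflection n (reflection n p) = p" for p
  proof -
    define k where "k = 2 * (n$1 * p$1 + n$2 * p$2 + n$3) / ?Q"
    have kQ: "k * ?Q = 2 * (n$1 * p$1 + n$2 * p$2 + n$3)" using Q by (simp add: k_def)
    have "2 * (n$1 * (p$1 - k * n$1) + n$2 * (p$2 - k * n$2) + n$3) = - (k * ?Q)"
      using kQ by algebra
    then have "2 * (n$1 * (p$1 - k * n$1) + n$2 * (p$2 - k * n$2) + n$3) / ?Q = - k"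
      using Q by simp
    then show ?thesis
      unfolding vec2_eq_iff reflection_nth k_def[symmetric] by simp
  qed
  have 4: "reflection n \<noteq> id"
  proof
    assume "reflection n = id"
    \<comment> \<open>a point \<open>p\<close> at which the affine form defining the line takes the value \<open>1\<close>\<close>
    define k where "k = (1 - n$3) / ?Q"
    define p :: "complex^2" where "p = k *s vector [n$1, n$2]"
    have "k * ?Q = 1 - n$3" using Q by (simp add: k_def)
    moreover have "p$1 = k * n$1" "p$2 = k * n$2" by (simp_all add: p_def vector_2)
    ultimately have "n$1 * p$1 + n$2 * p$2 + n$3 = 1" by algebra
    moreover have "reflection n p = p" using \<open>reflection n = id\<close> by simp
    ultimately have "n$1 = 0 \<and> n$2 = 0" using Q by (simp add: vec2_eq_iff reflection_nth)
    with Q show False by simp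
  qed
  have 5: "reflection n p = p" if "affine_point p \<in> line_of n" for p
    using that by (simp add: affine_in_line_of_iff vec2_eq_iff reflection_nth)
  show ?thesis
    unfolding is_symmetry_def using 1 2 3 4 5 by (auto simp: fun_eq_iff)
qed

text \<open>The linear part \<open>A\<close> fixes the direction \<open>d\<close> of the line. As it preserves \<open>quad\<close>, it
  maps the normal direction \<open>\<nu>\<close>, which is orthogonal to \<open>d\<close>, to \<open>l \<nu>\<close> with
  \<open>l\<^sup>2 = 1\<close>. The case \<open>l = 1\<close> is the identity and \<open>l = -1\<close> is the reflection.\<close>

lemma is_symmetry_unique:
  assumes Q: "(n$1)^2 + (n$2)^2 \<noteq> 0" and s: "is_symmetry (line_of n) s"
  shows "s = reflection n"
proof -
  let ?Q = "(n$1)^2 + (n$2)^2"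
  obtain A t where st: "s = (\<lambda>p. A *v p + t)" and qA: "\<And>v. quad (A *v v) = quad v"
    and nid: "s \<noteq> id" and fx: "\<And>p. affine_point p \<in> line_of n \<Longrightarrow> s p = p"
    using s unfolding is_symmetry_def by blast
  define \<nu> :: "complex^2" where "\<nu> = vector [n$1, n$2]"
  define d :: "complex^2" where "d = vector [- n$2, n$1]"
  define o' :: "complex^2" where "o' = (- n$3 / ?Q) *s \<nu>"
  have o0: "n$1 * o'$1 + n$2 * o'$2 = - n$3"
  proof -
    have "n$1 * o'$1 + n$2 * o'$2 = - n$3 / ?Q * ?Q"
      by (simp add: o'_def \<nu>_def vector_2 power2_eq_square algebra_simps add_divide_distrib)
    then show ?thesis using Q by simp
  qed
  \<comment> \<open>\<open>o'\<close> is the foot on the line of the perpendicular through the origin\<close>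
  have so: "A *v o' + t = o'"
    using fx[of o'] o0 by (simp add: affine_in_line_of_iff st)
  have "A *v (o' + d) + t = o' + d"
    using fx[of "o' + d"] o0 by (simp add: affine_in_line_of_iff st d_def vector_2 algebra_simps)
  then have "(A *v o' + t) + A *v d = o' + d"
    by (simp only: matrix_vector_right_distrib ac_simps)
  then have Ad: "A *v d = d" unfolding so by simp
  define \<mu> where "\<mu> = A *v \<nu>"
  have q1: "(\<mu>$1)^2 + (\<mu>$2)^2 = ?Q"
    using qA[of \<nu>] by (simp add: \<mu>_def quad_def \<nu>_def vector_2)
  have "quad (\<mu> + d) = quad (\<nu> + d)"
    using qA[of "\<nu> + d"] by (simp add: matrix_vector_right_distrib Ad \<mu>_def)
  then have "(\<mu>$1 - n$2)^2 + (\<mu>$2 + n$1)^2 = (n$1 - n$2)^2 + (n$2 + n$1)^2"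
    by (simp add: quad_def \<nu>_def d_def vector_2)
  then have orth: "n$1 * \<mu>$2 = n$2 * \<mu>$1" using q1 by algebra
  define l where "l = (n$1 * \<mu>$1 + n$2 * \<mu>$2) / ?Q"
  have lQ: "l * ?Q = n$1 * \<mu>$1 + n$2 * \<mu>$2" using Q by (simp add: l_def)
  have "?Q * \<mu>$1 = ?Q * (l * n$1)" "?Q * \<mu>$2 = ?Q * (l * n$2)" using lQ orth by algebra+
  then have \<mu>l: "\<mu>$1 = l * n$1" "\<mu>$2 = l * n$2" using Q unfolding mult_cancel_left by blast+
  have "l^2 * ?Q = 1 * ?Q" using q1 unfolding \<mu>l by algebra
  then have "l^2 = 1" using Q by simp
  \<comment> \<open>expand \<open>v\<close> in the orthogonal basis \<open>\<nu>, d\<close>, both of whose vectors have \<open>quad\<close> equal to \<open>?Q\<close>\<close>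
  have Avn: "?Q * (A *v v)$1 = (n$1 * v$1 + n$2 * v$2) * (l * n$1) - (n$1 * v$2 - n$2 * v$1) * n$2"
    "?Q * (A *v v)$2 = (n$1 * v$1 + n$2 * v$2) * (l * n$2) + (n$1 * v$2 - n$2 * v$1) * n$1" for v
  proof -
    have "?Q *s v = (n$1 * v$1 + n$2 * v$2) *s \<nu> + (n$1 * v$2 - n$2 * v$1) *s d"
      unfolding vec2_eq_iff \<nu>_def d_def
      by (simp add: vector_2 power2_eq_square algebra_simps)
    then have "A *v (?Q *s v) = A *v ((n$1 * v$1 + n$2 * v$2) *s \<nu> + (n$1 * v$2 - n$2 * v$1) *s d)"
      by (rule arg_cong)
    then have e: "?Q *s (A *v v) = (n$1 * v$1 + n$2 * v$2) *s \<mu> + (n$1 * v$2 - n$2 * v$1) *s d"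
      by (simp only: matrix_vector_right_distrib vector_scalar_commute Ad \<mu>_def)
    show "?Q * (A *v v)$1 = (n$1 * v$1 + n$2 * v$2) * (l * n$1) - (n$1 * v$2 - n$2 * v$1) * n$2"
      using arg_cong[OF e, of "\<lambda>x. x$1"]
      unfolding vector_add_component vector_smult_component \<mu>l d_def vector_2 by algebra
    show "?Q * (A *v v)$2 = (n$1 * v$1 + n$2 * v$2) * (l * n$2) + (n$1 * v$2 - n$2 * v$1) * n$1"
      using arg_cong[OF e, of "\<lambda>x. x$2"]
      unfolding vector_add_component vector_smult_component \<mu>l d_def vector_2 .
  qed
  have "l \<noteq> 1"
  proof
    assume "l = 1"
    have "?Q * (A *v v)$1 = ?Q * v$1" "?Q * (A *v v)$2 = ?Q * v$2" for v
      unfolding Avn \<open>l = 1\<close> by algebra+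
    then have "A *v v = v" for v using Q unfolding vec2_eq_iff mult_cancel_left by blast
    then have "s = id" using st so by (auto simp: fun_eq_iff)
    with nid show False ..
  qed
  with \<open>l^2 = 1\<close> have l: "l = -1" by (simp add: power2_eq_1_iff)
  have Av': "(A *v v)$1 = v$1 - 2 * (n$1 * v$1 + n$2 * v$2) / ?Q * n$1"
    "(A *v v)$2 = v$2 - 2 * (n$1 * v$1 + n$2 * v$2) / ?Q * n$2" for v
  proof -
    define k where "k = 2 * (n$1 * v$1 + n$2 * v$2) / ?Q"
    have "k * ?Q = 2 * (n$1 * v$1 + n$2 * v$2)" using Q by (simp add: k_def)
    then have "?Q * (A *v v)$1 = ?Q * (v$1 - k * n$1)" "?Q * (A *v v)$2 = ?Q * (v$2 - k * n$2)"
      unfolding Avn l by algebra+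
    then show "(A *v v)$1 = v$1 - 2 * (n$1 * v$1 + n$2 * v$2) / ?Q * n$1"
      "(A *v v)$2 = v$2 - 2 * (n$1 * v$1 + n$2 * v$2) / ?Q * n$2"
      using Q unfolding k_def[symmetric] mult_cancel_left by blast+
  qed
  have "t = o' - A *v o'" using so by (simp add: algebra_simps)
  then have t: "t$1 = 2 * (- n$3) / ?Q * n$1" "t$2 = 2 * (- n$3) / ?Q * n$2"
    by (simp_all only: vector_minus_component Av' o0) simp_all
  show ?thesis
    unfolding st fun_eq_iff vec2_eq_iff reflection_nth vector_add_component Av' t divide_inverse
    by (intro allI conjI; algebra)
qed

lemma symmetry_eq_reflection:
  assumes "(n$1)^2 + (n$2)^2 \<noteq> 0"
  shows "symmetry (line_of n) = reflection n"
  unfolding symmetry_def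
  using assms is_symmetry_reflection is_symmetry_unique by (intro the_equality) auto

lemma invertible_mult_eq_0_iff:
  assumes "invertible (N::complex^3^3)"
  shows "N *v v = 0 \<longleftrightarrow> v = 0"
proof
  assume N: "N *v v = 0"
  obtain K where "K ** N = mat 1" using assms by (auto simp: invertible_def)
  then have "v = K *v (N *v v)" by (simp add: matrix_vector_mul_assoc)
  with N show "v = 0" by simp
qed simp

text \<open>A projective map is determined by its restriction to the affine plane. Two matrices \<open>M\<close> and
  \<open>N\<close> of such maps agree up to a factor on each vector with nonzero last coordinate. A vector
  \<open>v\<close> at infinity lies on a projective line through the origin \<open>e\<close> of the affine plane, and three
  affine points of that line, namely \<open>e\<close>, \<open>v + e\<close> and \<open>v + 2 e\<close>, force the factors on it to be
  equal.\<close>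

lemma projective_map_eqI:
  assumes "projective_map g" "projective_map h"
    and eq: "\<And>p. g (affine_point p) = h (affine_point p)"
  shows "g = h"
proof
  fix P
  obtain M where M: "invertible M" "\<And>v. v \<noteq> 0 \<Longrightarrow> g (proj v) = proj (M *v v)"
    using assms(1) unfolding projective_map_def by blast
  obtain N where N: "invertible N" "\<And>v. v \<noteq> 0 \<Longrightarrow> h (proj v) = proj (N *v v)"
    using assms(2) unfolding projective_map_def by blast
  have aff: "\<exists>c. c \<noteq> 0 \<and> M *v v = c *s (N *v v)" if v: "v$3 \<noteq> 0" for v
  proof -
    have nz: "v \<noteq> 0" using v by auto
    have "proj v = affine_point (vector [v$1 / v$3, v$2 / v$3])"
      unfolding affine_point_def
      by (subst proj_eq_iff) (use v nz in \<open>auto simp: vec_eq_iff forall_3 vector_3 vector_2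
            intro!: exI[of _ "1 / v$3"]\<close>)
    then have "g (proj v) = h (proj v)" using eq by simp
    then have "proj (N *v v) = proj (M *v v)" using M N nz by simp
    then show ?thesis
      using M(1) N(1) nz by (simp add: proj_eq_iff invertible_mult_eq_0_iff)
  qed
  obtain v where v: "v \<noteq> 0" "P = proj v" by (rule proj_cases)
  have "\<exists>c. c \<noteq> 0 \<and> M *v v = c *s (N *v v)"
  proof (cases "v$3 = 0")
    case False
    then show ?thesis by (rule aff)
  next
    case True
    let ?e = "axis 3 1 :: complex^3"
    obtain c where c: "M *v ?e = c *s (N *v ?e)" using aff[of ?e] by (auto simp: axis_def)
    obtain k where k: "k \<noteq> 0" "M *v (v + ?e) = k *s (N *v (v + ?e))"
      using aff[of "v + ?e"] True by (auto simp: axis_def)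
    obtain m where m: "M *v (v + 2 *s ?e) = m *s (N *v (v + 2 *s ?e))"
      using aff[of "v + 2 *s ?e"] True by (auto simp: axis_def)
    have c': "M *v ?e = N *v (c *s ?e)" and k': "M *v (v + ?e) = N *v (k *s (v + ?e))"
      and m': "M *v (v + 2 *s ?e) = N *v (m *s (v + 2 *s ?e))"
      by (simp_all only: vector_scalar_commute c k(2) m)
    have "N *v (k *s (v + ?e) - c *s ?e) = M *v v"
      unfolding matrix_vector_mult_diff_distrib c'[symmetric] k'[symmetric]
      by (simp add: matrix_vector_right_distrib)
    moreover have "N *v (m *s (v + 2 *s ?e) - 2 *s (c *s ?e)) = M *v v"
      unfolding matrix_vector_mult_diff_distrib m'[symmetric] vector_scalar_commute[of N 2] c'[symmetric]
      by (simp add: matrix_vector_right_distrib vector_scalar_commute)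
    ultimately have Nv: "N *v (k *s (v + ?e) - c *s ?e) = M *v v"
      "N *v ((k *s (v + ?e) - c *s ?e) - (m *s (v + 2 *s ?e) - 2 *s (c *s ?e))) = 0"
      by (simp_all add: matrix_vector_mult_diff_distrib)
    then have z: "(k *s (v + ?e) - c *s ?e) - (m *s (v + 2 *s ?e) - 2 *s (c *s ?e)) = 0"
      using N(1) invertible_mult_eq_0_iff by blast
    have "(k - m) * v$1 = 0" "(k - m) * v$2 = 0" and kc: "k - c = 2 * (m - c)"
      using z True by (simp_all add: vec3_eq_0_iff axis_def algebra_simps)
    with v True have "k = m" by (auto simp: vec3_eq_0_iff)
    with kc have "k = c" by (simp add: algebra_simps)
    have "k *s (v + ?e) - c *s ?e = k *s v"
      by (simp add: \<open>k = c\<close> vec_eq_iff algebra_simps)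
    with Nv(1) have "M *v v = k *s (N *v v)" by (simp add: vector_scalar_commute)
    with k show ?thesis by blast
  qed
  then have "proj (N *v v) = proj (M *v v)"
    using M(1) N(1) v by (simp add: proj_eq_iff invertible_mult_eq_0_iff)
  then show "g P = h P" using M N v by simp
qed

lemma projective_extension_reflection:
  assumes Q: "(n$1)^2 + (n$2)^2 \<noteq> 0" and v: "v \<noteq> 0"
  shows "projective_extension (reflection n) (proj v) = proj (reflection_matrix n *v v)"
proof -
  let ?M = "reflection_matrix n"
  have inv: "invertible ?M"
  proof -
    have "?M ** ?M = mat 1"
      using reflection_matrix_involution[OF Q]
      by (simp add: matrix_eq matrix_vector_mul_assoc[symmetric])
    then show ?thesis by (auto simp: invertible_def)
  qed
  define g where "g P = proj (?M *v (SOME v. v \<noteq> 0 \<and> P = proj v))" for P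
  have g: "g (proj v) = proj (?M *v v)" if v: "v \<noteq> 0" for v
  proof -
    define w where "w = (SOME w. w \<noteq> 0 \<and> proj v = proj w)"
    have w: "w \<noteq> 0 \<and> proj v = proj w"
      unfolding w_def by (rule someI[of _ v]) (use v in auto)
    then obtain c where c: "c \<noteq> 0" "w = c *s v" using v proj_eq_iff by blast
    then have "?M *v w = c *s (?M *v v)" by (simp add: vector_scalar_commute)
    then have "proj (?M *v v) = proj (?M *v w)"
      using c w v inv by (subst proj_eq_iff) (auto simp: invertible_mult_eq_0_iff)
    then show ?thesis by (simp add: g_def w_def)
  qed
  have pg: "projective_map g" unfolding projective_map_def using g inv by blast
  have ag: "g (affine_point p) = affine_point (reflection n p)" for p
  proof -
    have "g (affine_point p) = proj (?M *v vector [p$1, p$2, 1])"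
      unfolding affine_point_def by (rule g) (simp add: vec3_eq_0_iff vector_3)
    also have "?M *v vector [p$1, p$2, 1] = vector [reflection n p $ 1, reflection n p $ 2, 1]"
      unfolding vec_eq_iff forall_3 reflection_matrix_mult_nth
      by (simp add: vector_3 reflection_nth sum_3)
    finally show ?thesis by (simp add: affine_point_def)
  qed
  have "projective_extension (reflection n) = g"
    unfolding projective_extension_def
    using pg ag projective_map_eqI by (intro the_equality) auto
  then show ?thesis using g v by simp
qed

lemma reflection_image_line_of:
  assumes Q: "(n$1)^2 + (n$2)^2 \<noteq> 0"
  shows "projective_extension (reflection n) ` line_of m = line_of (reflect_normal n m)"
proof -
  let ?M = "reflection_matrix n" and ?g = "projective_extension (reflection n)"
  have nz: "?M *v v \<noteq> 0" if "v \<noteq> 0" for v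
    using reflection_matrix_involution[OF Q, of v] that by auto
  show ?thesis
  proof
    show "?g ` line_of m \<subseteq> line_of (reflect_normal n m)"
    proof
      fix P assume "P \<in> ?g ` line_of m"
      then obtain v where v: "v \<noteq> 0" "pairing m v = 0" "P = ?g (proj v)"
        by (auto simp: line_of_def)
      have "pairing (reflect_normal n m) (?M *v v) = 0"
        using v(2) reflection_matrix_involution[OF Q, of v]
        by (simp only: pairing_reflection_matrix[symmetric])
      then show "P \<in> line_of (reflect_normal n m)"
        using v nz projective_extension_reflection[OF Q] by (simp add: proj_in_line_of_iff)
    qed
  next
    show "line_of (reflect_normal n m) \<subseteq> ?g ` line_of m"
    proof
      fix P assume "P \<in> line_of (reflect_normal n m)"
      then obtain v where v: "v \<noteq> 0" "pairing (reflect_normal n m) v = 0" "P = proj v"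
        by (auto simp: line_of_def)
      have "pairing m (?M *v v) = 0" using v(2) by (simp only: pairing_reflection_matrix)
      then have "proj (?M *v v) \<in> line_of m" using proj_in_line_of_iff[OF nz[OF v(1)]] by blast
      moreover have "?g (proj (?M *v v)) = P"
        using v nz projective_extension_reflection[OF Q] reflection_matrix_involution[OF Q] by simp
      ultimately show "P \<in> ?g ` line_of m" by blast
    qed
  qed
qed

section \<open>The invariant as a function of the line\<close>

text \<open>The value at the line \<open>n\<close> of the dual quadratic form of the conic, normalised by \<open>a b\<close> times
  the dual form of the pair of isotropic points.\<close>

definition line_joachimsthal :: "real \<Rightarrow> real \<Rightarrow> complex^3 \<Rightarrow> complex" where
  "line_joachimsthal a b n =
     (of_real a * (n$1)^2 + of_real b * (n$2)^2 - (n$3)^2) / (of_real a * of_real b * ((n$1)^2 + (n$2)^2))"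

lemma directing_vector_orthogonal:
  assumes "directing_vector v (line_of n)"
  shows "n$1 * v$1 + n$2 * v$2 = 0"
proof -
  obtain p where p: "{w. affine_point w \<in> line_of n} = range (\<lambda>t. p + t *s v)"
    using assms unfolding directing_vector_def by blast
  have on: "affine_point (p + t *s v) \<in> line_of n" for t
    using p by blast
  have "n$1 * p$1 + n$2 * p$2 + n$3 = 0" "n$1 * (p$1 + v$1) + n$2 * (p$2 + v$2) + n$3 = 0"
    using on[of 0] on[of 1] by (simp_all add: affine_in_line_of_iff)
  then show ?thesis by algebra
qed

text \<open>Put \<open>w = n\<^sub>2 x / a - n\<^sub>1 y / b\<close>, so that the invariant is \<open>w\<^sup>2 / (n\<^sub>1\<^sup>2 + n\<^sub>2\<^sup>2)\<close>.
  Lagrange's identity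
  \<open>(a n\<^sub>1\<^sup>2 + b n\<^sub>2\<^sup>2) (x\<^sup>2 / a + y\<^sup>2 / b) = (n\<^sub>1 x + n\<^sub>2 y)\<^sup>2 + a b w\<^sup>2\<close>
  eliminates the point: the second factor on the left is \<open>1\<close> and the first square on the right is
  \<open>n\<^sub>3\<^sup>2\<close>.\<close>

lemma joachimsthal_eq_line_joachimsthal:
  assumes a: "a \<noteq> 0" and b: "b \<noteq> 0" and Q: "(n$1)^2 + (n$2)^2 \<noteq> 0"
    and C: "affine_point p \<in> conic a b" and L: "affine_point p \<in> line_of n"
    and v: "directing_vector v (line_of n)"
  shows "joachimsthal a b p v = line_joachimsthal a b n"
proof -
  let ?a = "complex_of_real a" and ?b = "complex_of_real b" and ?Q = "(n$1)^2 + (n$2)^2"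
  have nz: "?a \<noteq> 0" "?b \<noteq> 0" using a b by simp_all
  have "conic_form a b (vector [p$1, p$2, 1]) = 0"
    using C unfolding affine_point_def
    by (subst (asm) proj_in_conic_iff) (auto simp: vec3_eq_0_iff vector_3)
  then have "(p$1)^2 / ?a + (p$2)^2 / ?b = 1" by (simp add: conic_form_def vector_3)
  then have C': "?b * (p$1)^2 + ?a * (p$2)^2 = ?a * ?b" using nz by (simp add: field_simps)
  have L': "n$1 * p$1 + n$2 * p$2 + n$3 = 0" using L by (simp add: affine_in_line_of_iff)
  have vn: "n$1 * v$1 + n$2 * v$2 = 0" by (rule directing_vector_orthogonal[OF v])
  define k where "k = (n$2 * v$1 - n$1 * v$2) / ?Q"
  have kQ: "k * ?Q = n$2 * v$1 - n$1 * v$2" using Q by (simp add: k_def)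
  have "?Q * v$1 = ?Q * (k * n$2)" "?Q * v$2 = ?Q * (- k * n$1)" using kQ vn by algebra+
  then have vk: "v$1 = k * n$2" "v$2 = - k * n$1" using Q by (simp_all only: mult_cancel_left) auto
  have "v \<noteq> 0" using v by (simp add: directing_vector_def)
  then have k: "k \<noteq> 0" using vk by (auto simp: vec2_eq_iff)
  have q: "quad v = k^2 * ?Q" unfolding quad_def vk by (simp add: algebra_simps)
  define w where "w = n$2 * p$1 / ?a - n$1 * p$2 / ?b"
  have w: "?a * ?b * w = ?b * n$2 * p$1 - ?a * n$1 * p$2"
    using nz by (simp add: w_def field_simps)
  have "(?a * ?b) * ((?a * ?b) * w^2) = (?a * ?b * w)^2" by (simp add: power2_eq_square)
  also have "\<dots> = (?a * ?b) * (?a * (n$1)^2 + ?b * (n$2)^2 - (n$3)^2)"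
    unfolding w using L' C' by algebra
  finally have "(?a * ?b) * w^2 = ?a * (n$1)^2 + ?b * (n$2)^2 - (n$3)^2" using nz by simp
  then have w2: "w^2 = (?a * (n$1)^2 + ?b * (n$2)^2 - (n$3)^2) / (?a * ?b)"
    using nz by (simp add: field_simps)
  have "p$1 * v$1 / ?a + p$2 * v$2 / ?b = k * w"
    unfolding vk w_def by (simp add: algebra_simps)
  then have "joachimsthal a b p v = (1 / (k^2 * ?Q)) * (k^2 * w^2)"
    unfolding joachimsthal_def q by (simp add: power_mult_distrib)
  also have "\<dots> = w^2 / ?Q" using k by simp
  finally show ?thesis unfolding w2 line_joachimsthal_def by simp
qed

text \<open>With \<open>n\<close> the tangent at \<open>u\<close>, the dual form of the conic takes at \<open>m - k n\<close> its value at
  \<open>m\<close> minus \<open>2 k\<close> times \<open>pairing m u\<close> plus \<open>k\<^sup>2\<close> times its value at \<open>n\<close>, which is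
  \<open>conic_form a b u\<close>. Both corrections vanish. The denominator is unchanged because \<open>k\<close> is
  chosen to make \<open>m \<mapsto> m - k n\<close> an orthogonal reflection for it.\<close>

lemma line_joachimsthal_reflect_normal:
  assumes a: "a \<noteq> 0" and b: "b \<noteq> 0"
    and C: "conic_form a b u = 0" and L: "pairing m u = 0"
    and Q: "(polar a b u $ 1)^2 + (polar a b u $ 2)^2 \<noteq> 0"
  shows "line_joachimsthal a b (reflect_normal (polar a b u) m) = line_joachimsthal a b m"
proof -
  let ?a = "complex_of_real a" and ?b = "complex_of_real b"
  define n where "n = polar a b u"
  define k where "k = 2 * (n$1 * m$1 + n$2 * m$2) / ((n$1)^2 + (n$2)^2)"
  have kQ: "k * ((n$1)^2 + (n$2)^2) = 2 * (n$1 * m$1 + n$2 * m$2)"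
    using Q by (simp add: k_def n_def)
  have nz: "?a \<noteq> 0" "?b \<noteq> 0" using a b by simp_all
  have u: "u$1 = ?a * n$1" "u$2 = ?b * n$2" "u$3 = - n$3"
    using nz by (simp_all add: n_def polar_def vector_3)
  have C': "?a * (n$1)^2 + ?b * (n$2)^2 - (n$3)^2 = 0"
    using C nz by (simp add: conic_form_def u power2_eq_square mult.left_commute)
  have L': "?a * n$1 * m$1 + ?b * n$2 * m$2 - n$3 * m$3 = 0"
    using L by (simp add: sum_3 u algebra_simps)
  have r: "reflect_normal n m $ i = m$i - k * n$i" for i
    by (simp add: reflect_normal_def k_def)
  have "(m$1 - k * n$1)^2 + (m$2 - k * n$2)^2 = (m$1)^2 + (m$2)^2"
    using kQ by algebra
  moreover have "?a * (m$1 - k * n$1)^2 + ?b * (m$2 - k * n$2)^2 - (m$3 - k * n$3)^2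
      = ?a * (m$1)^2 + ?b * (m$2)^2 - (m$3)^2"
    using C' L' by algebra
  ultimately show ?thesis
    unfolding line_joachimsthal_def n_def[symmetric] r by simp
qed

theorem proposition2p29:
  fixes a b :: real and T :: "cp2 list"
  assumes "a \<noteq> 0" and "b \<noteq> 0"
    and "length T = 3"
    and "nondegenerate_orbit a b T"
    and "non_isotropic_orbit T"
    and "finite_point (T ! 0)"
  shows "\<exists>c. \<forall>j<3. \<forall>k<2. \<forall>p v.
           T ! j = affine_point p \<and> (Suc k = j \<or> k = j) \<and> directing_vector v (side T k)
             \<longrightarrow> joachimsthal a b p v = c"
proof -
  have conic: "T ! j \<in> conic a b" if "j < 3" for j
    using assms(3,4) that nth_mem unfolding nondegenerate_orbit_def by (metis subsetD)
  have ne: "T ! 0 \<noteq> T ! 1" "T ! 1 \<noteq> T ! 2"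
    and tan: "\<not> isotropic (tangent_line a b (T ! 1))"
    and sym: "symmetric_lines (tangent_line a b (T ! 1)) (side T 0) (side T 1)"
    using assms(3,4) unfolding nondegenerate_orbit_def by (auto simp: numeral_2_eq_2)
  have iso: "\<not> isotropic (side T 0)" "\<not> isotropic (side T 1)"
    using assms(3,5) unfolding non_isotropic_orbit_def by auto
  obtain m where m: "side T 0 = line_of m" "T ! 0 \<in> line_of m" "T ! 1 \<in> line_of m"
    using line_through_is_line_of[OF ne(1)] by (auto simp: side_def)
  have on1: "T ! 1 \<in> side T 1" "T ! 2 \<in> side T 1"
    using line_through_is_line_of[OF ne(2)] by (auto simp: side_def numeral_2_eq_2)
  obtain u where u: "u \<noteq> 0" "T ! 1 = proj u" by (rule proj_cases)
  let ?n = "polar a b u"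
  have Q: "(?n$1)^2 + (?n$2)^2 \<noteq> 0"
    using tan u by (simp add: tangent_line_eq_polar isotropic_line_of_iff)
  have s1: "side T 1 = line_of (reflect_normal ?n m)"
    using sym unfolding symmetric_lines_def u(2) tangent_line_eq_polar[OF u(1)]
      symmetry_eq_reflection[OF Q] m(1) reflection_image_line_of[OF Q] by simp
  have J: "line_joachimsthal a b (reflect_normal ?n m) = line_joachimsthal a b m"
    using assms(1,2) conic[of 1] m(3) u Q
    by (intro line_joachimsthal_reflect_normal) (simp_all add: proj_in_conic_iff proj_in_line_of_iff)
  have "joachimsthal a b p v = line_joachimsthal a b m"
    if h: "j < 3" "k < 2" "T ! j = affine_point p" "Suc k = j \<or> k = j" "directing_vector v (side T k)"
    for j k p v
  proof -
    have C: "affine_point p \<in> conic a b" using conic[OF h(1)] h(3) by simp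
    consider "k = 0" "j = 0 \<or> j = 1" | "k = 1" "j = 1 \<or> j = 2"
      using h(2,4) by linarith
    then show ?thesis
    proof cases
      case 1
      have "T ! j \<in> line_of m" using 1(2) m(2,3) by (elim disjE) simp_all
      then have L: "affine_point p \<in> line_of m" using h(3) by simp
      show ?thesis
        using assms(1,2) iso(1) h(5) C L unfolding 1(1) m(1) isotropic_line_of_iff
        by (intro joachimsthal_eq_line_joachimsthal)
    next
      case 2
      have "T ! j \<in> line_of (reflect_normal ?n m)"
        using 2(2) on1 unfolding s1 by (elim disjE) simp_all
      then have L: "affine_point p \<in> line_of (reflect_normal ?n m)" using h(3) by simp
      show ?thesis
        using assms(1,2) iso(2) h(5) C L
        unfolding 2(1) s1 isotropic_line_of_iff J[symmetric]
        by (intro joachimsthal_eq_line_joachimsthal)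
    qed
  qed
  then show ?thesis by blast
qed

end
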